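(* Let $F$ be a forest with $|V(F)|\le 13$. Then $\chi_{\mathrm{g}}(F)\le 3$.
   Context: The $t$-coloring game on a finite graph $G$ with a set $C$ of $t$ colors: Alice and Bob alternate turns, Alice first, each coloring an uncolored vertex with a color from $C$ not used on any of its neighbors. Bob wins if at some point an uncolored vertex has no such color available; otherwise Alice wins when all vertices are colored. The game chromatic number $\chi_{\mathrm{g}}(G)$ is the least $t$ such that Alice has a winning strategy in the $t$-coloring game on the initially uncolored graph $G$. *)

theory Defs
  imports Main
begin

definition simple_graph :: "'a set \<Rightarrow> ('a \<Rightarrow> 'a \<Rightarrow> bool) \<Rightarrow> bool" where
  "simple_graph V E \<longleftrightarrow> finite V \<and> (\<forall>u v. E u v \<longrightarrow> E v u)
     \<and> (\<forall>v. \<not> E v v) \<and> (\<forall>u v. E u v \<longrightarrow> u \<in> V \<and> v \<in> V)"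

definition is_cycle :: "'a set \<Rightarrow> ('a \<Rightarrow> 'a \<Rightarrow> bool) \<Rightarrow> 'a list \<Rightarrow> bool" where
  "is_cycle V E vs \<longleftrightarrow> length vs \<ge> 3 \<and> distinct vs \<and> set vs \<subseteq> V
     \<and> (\<forall>i < length vs. E (vs ! i) (vs ! ((i + 1) mod length vs)))"

definition forest :: "'a set \<Rightarrow> ('a \<Rightarrow> 'a \<Rightarrow> bool) \<Rightarrow> bool" where
  "forest V E \<longleftrightarrow> simple_graph V E \<and> (\<nexists>vs. is_cycle V E vs)"

definition legal_move :: "nat \<Rightarrow> 'a set \<Rightarrow> ('a \<Rightarrow> 'a \<Rightarrow> bool) \<Rightarrow> ('a \<Rightarrow> nat option)
    \<Rightarrow> 'a \<Rightarrow> nat \<Rightarrow> bool" where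
  "legal_move t V E c v k \<longleftrightarrow> v \<in> V \<and> c v = None \<and> k < t \<and> (\<forall>u. E u v \<longrightarrow> c u \<noteq> Some k)"

text \<open>Bob has won: some uncoloured vertex has no available colour.\<close>
definition stuck :: "nat \<Rightarrow> 'a set \<Rightarrow> ('a \<Rightarrow> 'a \<Rightarrow> bool) \<Rightarrow> ('a \<Rightarrow> nat option) \<Rightarrow> bool" where
  "stuck t V E c \<longleftrightarrow> (\<exists>v \<in> V. c v = None \<and> (\<forall>k < t. \<exists>u. E u v \<and> c u = Some k))"

definition all_colored :: "'a set \<Rightarrow> ('a \<Rightarrow> nat option) \<Rightarrow> bool" where
  "all_colored V c \<longleftrightarrow> (\<forall>v \<in> V. c v \<noteq> None)"

text \<open>alice_wins_A: Alice to move and Alice has a winning strategy;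
alice_wins_B: Bob to move and Alice has a winning strategy.\<close>

inductive alice_wins_A and alice_wins_B ::
    "nat \<Rightarrow> 'a set \<Rightarrow> ('a \<Rightarrow> 'a \<Rightarrow> bool) \<Rightarrow> ('a \<Rightarrow> nat option) \<Rightarrow> bool"
  for t :: nat and V :: "'a set" and E :: "'a \<Rightarrow> 'a \<Rightarrow> bool" where
  A_done: "\<not> stuck t V E c \<Longrightarrow> all_colored V c \<Longrightarrow> alice_wins_A t V E c"
| A_move: "\<not> stuck t V E c \<Longrightarrow> legal_move t V E c v k \<Longrightarrow> alice_wins_B t V E (c(v := Some k))
            \<Longrightarrow> alice_wins_A t V E c"
| B_done: "\<not> stuck t V E c \<Longrightarrow> all_colored V c \<Longrightarrow> alice_wins_B t V E c"
| B_move: "\<not> stuck t V E c \<Longrightarrow> \<not> all_colored V c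
            \<Longrightarrow> (\<And>v k. legal_move t V E c v k \<Longrightarrow> alice_wins_A t V E (c(v := Some k)))
            \<Longrightarrow> alice_wins_B t V E c"

definition alice_wins_game :: "nat \<Rightarrow> 'a set \<Rightarrow> ('a \<Rightarrow> 'a \<Rightarrow> bool) \<Rightarrow> bool" where
  "alice_wins_game t V E \<longleftrightarrow> alice_wins_A t V E (\<lambda>_. None)"

definition game_chromatic_number :: "'a set \<Rightarrow> ('a \<Rightarrow> 'a \<Rightarrow> bool) \<Rightarrow> nat" where
  "game_chromatic_number V E = (LEAST t. alice_wins_game t V E)"

end

theory Submission
  imports Defs
begin

text \<open>Only an uncoloured vertex whose seen colours and uncoloured neighbours number at least three
in total, a \<^emph>\<open>dangerous\<close> vertex, can ever get stuck. Alice keeps the following after each of her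
moves: a dangerous vertex sees at most one colour, and an uncoloured component contains at most
two of them; if it contains two, at most one of its vertices has coloured neighbours and one of the
two has potential at most three. A move of Bob only affects one component, and Alice can answer
there so that at most one dangerous vertex is left in it.

For the first move, give every vertex weight degree minus one. In a forest with at most \<open>13\<close>
vertices the total weight is at most \<open>11\<close>, so there is a vertex \<open>x\<close> such that all components
left by its removal have weight at most \<open>5\<close>. Such a component violates no part of the invariant,
since three vertices of degree at least \<open>3\<close> as well as two of degree at least \<open>4\<close> weigh at
least \<open>6\<close>. Alice colours \<open>x\<close>.\<close>

locale forest_graph =
  fixes V :: "'a set" and E :: "'a \<Rightarrow> 'a \<Rightarrow> bool"
  assumes forest: "forest V E"
begin

lemma sym: "E u v \<Longrightarrow> E v u"
  and irrefl: "\<not> E v v"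
  and in_V: "E u v \<Longrightarrow> u \<in> V" "E u v \<Longrightarrow> v \<in> V"
  and finite_V: "finite V"
  using forest unfolding forest_def simple_graph_def by blast+

section \<open>Paths and components\<close>

text \<open>A one-element list is a path vacuously and may lie outside \<open>V\<close>, hence the
  length bound.\<close>

lemma path_subset_V:
  assumes "successively E vs" "length vs \<ge> 2"
  shows "set vs \<subseteq> V"
proof
  fix v assume "v \<in> set vs"
  then obtain i where i: "i < length vs" "v = vs ! i" by (auto simp: in_set_conv_nth)
  show "v \<in> V"
  proof (cases i)
    case 0
    then show ?thesis using assms i in_V(1)[of v "vs ! 1"] by (auto simp: successively_conv_nth)
  next
    case (Suc j)
    then show ?thesis using assms i in_V(2)[of "vs ! j" v] by (auto simp: successively_conv_nth)
  qed
qed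

text \<open>Acyclicity restated for paths, so that later arguments avoid modular indices.\<close>

lemma no_closed_path:
  assumes "distinct vs" "successively E vs" "length vs \<ge> 3"
  shows "\<not> E (last vs) (hd vs)"
proof
  assume close: "E (last vs) (hd vs)"
  have "E (vs ! i) (vs ! ((i + 1) mod length vs))" if "i < length vs" for i
  proof (cases "i + 1 < length vs")
    case True
    then show ?thesis using assms(2) by (auto simp: successively_conv_nth)
  next
    case False
    with that have "i = length vs - 1" "i + 1 = length vs" by auto
    moreover have "vs \<noteq> []" using that by auto
    ultimately show ?thesis using close by (simp add: last_conv_nth hd_conv_nth)
  qed
  moreover have "set vs \<subseteq> V" using path_subset_V assms by simp
  ultimately have "is_cycle V E vs" using assms unfolding is_cycle_def by blast
  then show False using forest unfolding forest_def by blast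
qed

text \<open>\<open>X\<close> is the set of deleted vertices: \<open>{x}\<close> for the centroid,
  \<open>dom c\<close> for uncoloured components. The relation stays reflexive on \<open>X\<close>
  itself.\<close>

definition reach :: "'a set \<Rightarrow> 'a \<Rightarrow> 'a \<Rightarrow> bool" where
  "reach X = (\<lambda>a b. E a b \<and> a \<notin> X \<and> b \<notin> X)\<^sup>*\<^sup>*"

lemma reach_refl [simp]: "reach X a a"
  by (simp add: reach_def)

lemma reach_edge: "E a b \<Longrightarrow> a \<notin> X \<Longrightarrow> b \<notin> X \<Longrightarrow> reach X a b"
  by (auto simp: reach_def)

lemma reach_trans: "reach X a b \<Longrightarrow> reach X b c \<Longrightarrow> reach X a c"
  by (auto simp: reach_def)

lemma reach_sym: "reach X a b \<Longrightarrow> reach X b a"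
  unfolding reach_def by (rule sympD[OF symp_rtranclp[OF sympI]]) (use sym in blast)+

lemma reach_mono: "reach Y a b \<Longrightarrow> X \<subseteq> Y \<Longrightarrow> reach X a b"
  unfolding reach_def by (erule rtranclp_mono[THEN predicate2D, rotated]) auto

lemma reach_avoids: "reach X a b \<Longrightarrow> a \<notin> X \<Longrightarrow> b \<notin> X"
  unfolding reach_def by (induction rule: rtranclp_induct) auto

lemma reach_in_V: "reach X a b \<Longrightarrow> a \<in> V \<Longrightarrow> b \<in> V"
  unfolding reach_def by (induction rule: rtranclp_induct) (auto dest: in_V)

lemma reach_path:
  assumes "reach X a b" "b \<notin> X"
  shows "\<exists>vs. vs \<noteq> [] \<and> hd vs = a \<and> last vs = b \<and> distinct vs \<and> successively E vs \<and> set vs \<inter> X = {}"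
  using assms unfolding reach_def
proof (induction rule: converse_rtranclp_induct)
  case base
  then show ?case by (intro exI[of _ "[b]"]) auto
next
  case (step y z)
  then obtain vs where vs: "vs \<noteq> []" "hd vs = z" "last vs = b" "distinct vs"
    "successively E vs" "set vs \<inter> X = {}" by blast
  show ?case
  proof (cases "y \<in> set vs")
    case True
    then obtain ps qs where "vs = ps @ y # qs" by (meson split_list)
    then show ?thesis using vs by (intro exI[of _ "y # qs"]) (auto simp: successively_append_iff)
  next
    case False
    then show ?thesis using vs step.hyps
      by (intro exI[of _ "y # vs"]) (auto simp: successively_Cons)
  qed
qed

text \<open>A path from \<open>a\<close> to \<open>b\<close> avoiding \<open>X\<close>, together
  with \<open>x\<close>, would close a cycle.\<close>

lemma neighbours_separated:
  assumes "E x a" "E x b" "x \<in> X" "reach X a b"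
  shows "a = b"
proof (rule ccontr)
  assume ne: "a \<noteq> b"
  from assms(4)[unfolded reach_def] ne have "a \<notin> X"
    by (cases rule: converse_rtranclpE) auto
  then have "b \<notin> X" using assms(4) reach_avoids by blast
  then obtain vs where vs: "vs \<noteq> []" "hd vs = a" "last vs = b" "distinct vs"
    "successively E vs" "set vs \<inter> X = {}" using reach_path[OF assms(4)] by blast
  have "length vs \<ge> 2"
    using vs(1-3) ne by (cases vs; cases "tl vs") auto
  moreover have "x \<notin> set vs" using vs(6) assms(3) by auto
  ultimately have "\<not> E (last (x # vs)) (hd (x # vs))"
    using vs assms(1) by (intro no_closed_path) (auto simp: successively_Cons)
  then show False using vs assms(2) sym by auto
qed

lemma no_triangle: "\<not> (E a b \<and> E b c \<and> E a c)"
proof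
  assume "E a b \<and> E b c \<and> E a c"
  then have e: "E a b" "E b c" "E a c" by auto
  then have "b \<noteq> a" "c \<noteq> a" "b \<noteq> c" using irrefl by auto
  then show False
    using neighbours_separated[OF e(1,3), of "{a}"] reach_edge[OF e(2), of "{a}"] by simp
qed

lemma no_square:
  assumes "E a b" "E b c" "E c d" "a \<noteq> c" "b \<noteq> d"
  shows "\<not> E d a"
proof
  assume "E d a"
  have "reach {a} b d"
    by (rule reach_trans[OF reach_edge[of b c] reach_edge]) (use assms \<open>E d a\<close> irrefl in auto)
  then show False using neighbours_separated[of a b d "{a}"] assms \<open>E d a\<close> sym by blast
qed

section \<open>A centroid for the weight degree minus one\<close>

definition nbrs :: "'a \<Rightarrow> 'a set" where
  "nbrs v = {u. E u v}"

lemma finite_nbrs [simp]: "finite (nbrs v)"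
  by (rule finite_subset[OF _ finite_V]) (auto simp: nbrs_def in_V)

text \<open>A path in \<open>A\<close> of maximal length starts at a leaf.\<close>

lemma exists_leaf:
  assumes "A \<subseteq> V" "A \<noteq> {}"
  shows "\<exists>l\<in>A. card (nbrs l \<inter> A) \<le> 1"
proof -
  let ?P = "\<lambda>vs. vs \<noteq> [] \<and> distinct vs \<and> successively E vs \<and> set vs \<subseteq> A"
  have fA: "finite A" using assms finite_V finite_subset by blast
  obtain a where "a \<in> A" using assms by blast
  then have "?P [a]" by simp
  moreover have "\<forall>vs. ?P vs \<longrightarrow> length vs < Suc (card A)"
    by (metis distinct_card card_mono fA le_imp_less_Suc)
  ultimately obtain vs where vs: "?P vs" and max: "\<And>ws. ?P ws \<Longrightarrow> length ws \<le> length vs"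
    using ex_has_greatest_nat[of ?P "[a]" length "Suc (card A)"] by blast
  \<comment> \<open>A further neighbour of the head would close a cycle if it lies on the path, and
    lengthen the path otherwise. For a one-vertex path \<open>vs ! 1\<close> is unspecified, but
    then no such \<open>z\<close> exists.\<close>
  have "z = vs ! 1" if z: "z \<in> A" "E z (hd vs)" for z
  proof (rule ccontr)
    assume ne: "z \<noteq> vs ! 1"
    show False
    proof (cases "z \<in> set vs")
      case True
      then obtain j where j: "j < length vs" "z = vs ! j" by (auto simp: in_set_conv_nth)
      have "j \<noteq> 0" using z j vs irrefl by (metis hd_conv_nth)
      with ne j have "j \<ge> 2" by (cases "j = 1") auto
      let ?ws = "take (Suc j) vs"
      have "successively E ?ws"
        using vs by (metis append_take_drop_id successively_append_iff)
      moreover have "distinct ?ws" using vs by auto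
      moreover have "length ?ws \<ge> 3" using \<open>j \<ge> 2\<close> j by simp
      moreover have "last ?ws = z" "hd ?ws = hd vs"
        using j vs by (simp_all add: take_Suc_conv_app_nth hd_append hd_conv_nth)
      ultimately show False using no_closed_path[of ?ws] z by simp
    next
      case False
      then have "?P (z # vs)" using vs z by (auto simp: successively_Cons)
      then show False using max by fastforce
    qed
  qed
  then have "nbrs (hd vs) \<inter> A \<subseteq> {vs ! 1}" by (auto simp: nbrs_def)
  then have "card (nbrs (hd vs) \<inter> A) \<le> 1" using card_mono[of "{vs ! 1}"] by fastforce
  then show ?thesis using vs by (meson hd_in_set subsetD)
qed

text \<open>The sum is twice the number of edges inside \<open>A\<close>; removing a leaf loses at
  most one edge, counted once at each end.\<close>

lemma degree_sum:
  assumes "A \<subseteq> V" "A \<noteq> {}"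
  shows "(\<Sum>v\<in>A. card (nbrs v \<inter> A)) + 2 \<le> 2 * card A"
  using assms
proof (induction "card A" arbitrary: A rule: less_induct)
  case less
  have fA: "finite A" using less.prems finite_V finite_subset by blast
  obtain l where l: "l \<in> A" "card (nbrs l \<inter> A) \<le> 1" using exists_leaf less.prems by blast
  let ?B = "A - {l}"
  have cA: "card A = Suc (card ?B)" using l fA by (metis card.remove)
  show ?case
  proof (cases "?B = {}")
    case True
    then have "A = {l}" using l by auto
    moreover have "nbrs l \<inter> {l} = {}" using irrefl by (auto simp: nbrs_def)
    ultimately show ?thesis by simp
  next
    case False
    have "card (nbrs v \<inter> A) = card (nbrs v \<inter> ?B) + (if v \<in> nbrs l then 1 else 0)" for v
    proof (cases "v \<in> nbrs l")
      case True
      then have "nbrs v \<inter> A = insert l (nbrs v \<inter> ?B)" using l sym by (auto simp: nbrs_def)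
      then show ?thesis using True by simp
    next
      case False
      then have "nbrs v \<inter> A = nbrs v \<inter> ?B" using sym by (auto simp: nbrs_def)
      then show ?thesis using False by simp
    qed
    then have "(\<Sum>v\<in>?B. card (nbrs v \<inter> A))
        = (\<Sum>v\<in>?B. card (nbrs v \<inter> ?B)) + card (?B \<inter> nbrs l)"
      using fA by (simp add: sum.distrib sum.If_cases)
    moreover have "?B \<inter> nbrs l = nbrs l \<inter> A" using irrefl by (auto simp: nbrs_def)
    then have "card (?B \<inter> nbrs l) = card (nbrs l \<inter> A)" by (rule arg_cong)
    moreover have "(\<Sum>v\<in>A. card (nbrs v \<inter> A))
        = card (nbrs l \<inter> A) + (\<Sum>v\<in>?B. card (nbrs v \<inter> A))"
      using l fA by (meson sum.remove)
    moreover have "(\<Sum>v\<in>?B. card (nbrs v \<inter> ?B)) + 2 \<le> 2 * card ?B"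
      using less.hyps[of ?B] less.prems False cA by auto
    ultimately show ?thesis using l(2) cA by linarith
  qed
qed

text \<open>Truncated subtraction gives isolated vertices, like leaves, weight \<open>0\<close>.\<close>

definition weight :: "'a set \<Rightarrow> nat" where
  "weight A = (\<Sum>v\<in>A. card (nbrs v) - 1)"

lemma weight_mono: "A \<subseteq> B \<Longrightarrow> B \<subseteq> V \<Longrightarrow> weight A \<le> weight B"
  unfolding weight_def by (rule sum_mono2) (use finite_V finite_subset in auto)

text \<open>If there are \<open>n > 0\<close> non-isolated vertices, their degrees sum to at most
  \<open>2n - 2\<close>, and subtracting one for each leaves \<open>n - 2\<close>.\<close>

lemma weight_V: "weight V \<le> card V - 2"
proof -
  let ?A = "{v\<in>V. nbrs v \<noteq> {}}"
  have fA: "finite ?A" using finite_V by simp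
  have "weight V = weight ?A"
    unfolding weight_def by (rule sum.mono_neutral_right) (auto simp: finite_V)
  also have "\<dots> = (\<Sum>v\<in>?A. card (nbrs v \<inter> ?A)) - card ?A"
  proof -
    have "nbrs v \<inter> ?A = nbrs v" for v
      using sym in_V by (auto simp: nbrs_def)
    moreover have "(\<Sum>v\<in>?A. card (nbrs v)) = weight ?A + card ?A"
    proof -
      have "(\<Sum>v\<in>?A. card (nbrs v)) = (\<Sum>v\<in>?A. (card (nbrs v) - 1) + 1)"
        by (rule sum.cong) (auto simp: Suc_le_eq card_gt_0_iff)
      then show ?thesis unfolding weight_def by (simp only: sum.distrib) simp
    qed
    ultimately show ?thesis by simp
  qed
  also have "\<dots> \<le> card V - 2"
  proof (cases "?A = {}")
    case False
    have "?A \<subseteq> V" by auto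
    then have "card ?A \<le> card V" using finite_V card_mono by blast
    then show ?thesis using degree_sum[of ?A] False by force
  qed (simp only: sum.empty)
  finally show ?thesis .
qed

text \<open>If every vertex left a heavy component, a smallest one \<open>K\<close>, cut off by \<open>x\<close>, would be cut
further by its unique vertex adjacent to \<open>x\<close>, since two heavy components cannot be disjoint.\<close>

lemma exists_centroid:
  assumes "weight V < 2 * h" "V \<noteq> {}"
  shows "\<exists>x\<in>V. \<forall>u\<in>V - {x}. weight {v. reach {x} u v} < h"
proof (rule ccontr)
  assume contra: "\<not> ?thesis"
  define K where "K x u = {v. reach {x} u v}" for x u
  let ?Q = "\<lambda>(x, u). x \<in> V \<and> u \<in> V - {x} \<and> weight (K x u) \<ge> h"
  have heavy: "\<exists>u. ?Q (x, u)" if "x \<in> V" for x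
    using contra that unfolding K_def by (force simp: not_less)
  then obtain p where "?Q p" using assms(2) by blast
  then obtain q where q: "?Q q" and min: "\<And>q'. ?Q q' \<Longrightarrow> card (K (fst q) (snd q)) \<le> card (K (fst q') (snd q'))"
    using ex_has_least_nat[of ?Q p "\<lambda>q. card (K (fst q) (snd q))"] by blast
  obtain x u where xu: "q = (x, u)" by fastforce
  have x: "x \<in> V" "u \<in> V" "u \<noteq> x" "weight (K x u) \<ge> h" using q xu by auto
  have KV: "K y z \<subseteq> V" if "z \<in> V" for y z using that reach_in_V by (auto simp: K_def)
  \<comment> \<open>\<open>y\<close> is the only possible exit from the component towards
    \<open>x\<close>; if there is none, \<open>u\<close> serves vacuously.\<close>
  obtain y where y: "y \<in> K x u" and only: "\<And>z. z \<in> K x u \<Longrightarrow> E z x \<Longrightarrow> z = y"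
  proof (cases "\<exists>y\<in>K x u. E y x")
    case True
    then obtain y where y: "y \<in> K x u" "E y x" by blast
    have "z = y" if "z \<in> K x u" "E z x" for z
      using neighbours_separated[of x z y "{x}"] that y reach_sym reach_trans sym
      unfolding K_def by blast
    with y that show ?thesis by blast
  next
    case False
    with that[of u] show ?thesis by (auto simp: K_def)
  qed
  then have yV: "y \<in> V" using KV x by blast
  then obtain u' where u': "u' \<in> V" "u' \<noteq> y" "weight (K y u') \<ge> h" using heavy by auto
  have "K y u' \<inter> K x u \<noteq> {}"
  proof
    assume "K y u' \<inter> K x u = {}"
    then have "weight (K y u' \<union> K x u) = weight (K y u') + weight (K x u)"
      unfolding weight_def by (intro sum.union_disjoint) (meson KV finite_V finite_subset u'(1) x(2))+
    moreover have "weight (K y u' \<union> K x u) \<le> weight V"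
      using KV u'(1) x(2) by (intro weight_mono) auto
    ultimately show False using assms(1) u' x by simp
  qed
  then obtain z where z: "reach {y} u' z" "z \<in> K x u" by (auto simp: K_def)
  \<comment> \<open>A walk from \<open>z\<close> avoiding \<open>y\<close> cannot leave the
    component of \<open>u\<close>: it would have to step to \<open>x\<close>, which is possible only
    from \<open>y\<close>.\<close>
  have "v \<in> K x u" if "reach {y} z v" for v
    using that z(2) unfolding reach_def
  proof (induction rule: rtranclp_induct)
    case (step a b)
    have "a \<in> K x u" using step by blast
    moreover have "a \<noteq> x" using reach_avoids[of "{x}" u a] x calculation by (auto simp: K_def)
    moreover have "b \<noteq> x" using only[of a] calculation step by auto
    ultimately show ?case using step reach_trans[of "{x}" u a b] reach_edge[of a b "{x}"]
      by (auto simp: K_def)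
  qed
  then have "K y u' \<subseteq> K x u"
    using z(1) reach_sym reach_trans unfolding K_def by blast
  moreover have "y \<notin> K y u'" using reach_avoids[of "{y}" u' y] u' by (auto simp: K_def)
  ultimately have "K y u' \<subset> K x u" using y by blast
  then have "card (K y u') < card (K x u)"
    by (meson KV finite_V finite_subset psubset_card_mono x(2))
  then show False using min[of "(y, u')"] yV u' xu by auto
qed

section \<open>Dangerous vertices\<close>

definition seen :: "('a \<Rightarrow> nat option) \<Rightarrow> 'a \<Rightarrow> nat set" where
  "seen c v = {k. \<exists>u. E u v \<and> c u = Some k}"

definition free_nbrs :: "('a \<Rightarrow> nat option) \<Rightarrow> 'a \<Rightarrow> 'a set" where
  "free_nbrs c v = {u. E u v \<and> c u = None}"

text \<open>An upper bound on the number of colours that can ever appear around \<open>v\<close>.\<close>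

definition potential :: "('a \<Rightarrow> nat option) \<Rightarrow> 'a \<Rightarrow> nat" where
  "potential c v = card (seen c v) + card (free_nbrs c v)"

definition dangerous :: "('a \<Rightarrow> nat option) \<Rightarrow> 'a set" where
  "dangerous c = {v \<in> V. c v = None \<and> 3 \<le> potential c v}"

lemma finite_free_nbrs [simp]: "finite (free_nbrs c v)"
  by (rule finite_subset[OF _ finite_nbrs[of v]]) (auto simp: free_nbrs_def nbrs_def)

lemma finite_seen [simp]: "finite (seen c v)"
proof -
  have "seen c v \<subseteq> (\<lambda>u. the (c u)) ` nbrs v" by (force simp: seen_def nbrs_def)
  then show ?thesis using finite_surj finite_nbrs by blast
qed

lemma seen_upd:
  assumes "c w = None"
  shows "seen (c(w := Some k)) v = seen c v \<union> (if E w v then {k} else {})"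
proof -
  have "(\<exists>u. E u v \<and> (c(w := Some k)) u = Some x) \<longleftrightarrow> (\<exists>u. E u v \<and> c u = Some x) \<or> E w v \<and> x = k" for x
    using assms by (metis fun_upd_apply option.inject option.distinct(1))
  then show ?thesis by (auto simp: seen_def simp del: fun_upd_apply)
qed

lemma card_seen_upd: "c w = None \<Longrightarrow> card (seen (c(w := Some k)) v) \<le> card (seen c v) + 1"
  by (simp add: seen_upd card_insert_if)

text \<open>Colouring a free neighbour removes it from the free neighbours and adds at most one seen
  colour; colouring any other vertex changes neither.\<close>

lemma potential_upd:
  assumes "c w = None"
  shows "potential (c(w := Some k)) v \<le> potential c v"
proof (cases "E w v")
  case True
  have "free_nbrs c v = insert w (free_nbrs (c(w := Some k)) v)"
    using True assms by (auto simp: free_nbrs_def)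
  moreover have "w \<notin> free_nbrs (c(w := Some k)) v" by (simp add: free_nbrs_def)
  ultimately have "card (free_nbrs c v) = Suc (card (free_nbrs (c(w := Some k)) v))" by simp
  then show ?thesis using card_seen_upd[of c w k v] assms by (simp add: potential_def)
next
  case False
  then have "free_nbrs (c(w := Some k)) v = free_nbrs c v"
    by (auto simp: free_nbrs_def)
  then show ?thesis using False assms by (simp add: potential_def seen_upd)
qed

text \<open>Potentials never increase, so no vertex becomes dangerous during play.\<close>

lemma dangerous_upd: "c w = None \<Longrightarrow> dangerous (c(w := Some k)) \<subseteq> dangerous c - {w}"
  using order_trans[OF _ potential_upd[of c w k]] unfolding dangerous_def
  by (auto split: if_splits)

section \<open>Availability of colours\<close>

lemma legal_move_iff:
  "legal_move 3 V E c v k \<longleftrightarrow> v \<in> V \<and> c v = None \<and> k < 3 \<and> k \<notin> seen c v"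
  by (auto simp: legal_move_def seen_def)

lemma exists_legal:
  assumes "v \<in> V" "c v = None" "card (seen c v) \<le> 2"
  shows "\<exists>k. legal_move 3 V E c v k"
proof -
  have "\<not> {..<3} \<subseteq> seen c v"
    using card_mono[of "seen c v" "{..<3::nat}"] assms(3) by auto
  then show ?thesis using assms by (auto simp: legal_move_iff)
qed

text \<open>An uncoloured vertex that is not dangerous has potential at most \<open>2\<close>, which
  bounds its seen colours.\<close>

lemma seen_le_2:
  assumes "\<forall>v\<in>dangerous c. card (seen c v) \<le> 2" "v \<in> V" "c v = None"
  shows "card (seen c v) \<le> 2"
proof (cases "v \<in> dangerous c")
  case False
  then show ?thesis using assms by (auto simp: dangerous_def potential_def)
qed (use assms in blast)

lemma not_stuck:
  assumes "\<forall>v\<in>dangerous c. card (seen c v) \<le> 2"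
  shows "\<not> stuck 3 V E c"
proof
  assume "stuck 3 V E c"
  then obtain v where v: "v \<in> V" "c v = None" "\<forall>k<3. k \<in> seen c v"
    by (auto simp: stuck_def seen_def)
  then have "\<exists>k. legal_move 3 V E c v k" using exists_legal seen_le_2 assms by blast
  with v show False by (auto simp: legal_move_iff)
qed

section \<open>Alice's invariant\<close>

text \<open>The last clause lets the one exposed vertex have several coloured neighbours. The
  clauses speak of the component of \<open>u\<close>, which is also that of \<open>v\<close>
  wherever the predicate is applied.\<close>

definition good_pair :: "('a \<Rightarrow> nat option) \<Rightarrow> 'a \<Rightarrow> 'a \<Rightarrow> bool" where
  "good_pair c u v \<longleftrightarrow>
     (potential c u \<le> 3 \<or> potential c v \<le> 3) \<and>
     (\<forall>w\<in>dangerous c. reach (dom c) u w \<longrightarrow> w = u \<or> w = v) \<and>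
     (\<forall>a a' b b'. reach (dom c) u a \<longrightarrow> reach (dom c) u a' \<longrightarrow> b \<in> dom c \<longrightarrow> b' \<in> dom c \<longrightarrow>
        E a b \<longrightarrow> E a' b' \<longrightarrow> a = a')"

text \<open>The bound \<open>1\<close> leaves room for one more colour from Bob before Alice
  replies.\<close>

definition good :: "('a \<Rightarrow> nat option) \<Rightarrow> bool" where
  "good c \<longleftrightarrow> (\<forall>v\<in>dangerous c. card (seen c v) \<le> 1) \<and>
     (\<forall>u\<in>dangerous c. \<forall>v\<in>dangerous c. u \<noteq> v \<longrightarrow> reach (dom c) u v \<longrightarrow> good_pair c u v)"

lemma good_seen: "good c \<Longrightarrow> v \<in> dangerous c \<Longrightarrow> card (seen c v) \<le> 1"
  and good_good_pair: "good c \<Longrightarrow> u \<in> dangerous c \<Longrightarrow> v \<in> dangerous c \<Longrightarrow> u \<noteq> v \<Longrightarrow>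
    reach (dom c) u v \<Longrightarrow> good_pair c u v"
  unfolding good_def by blast+

text \<open>Moves inside one uncoloured component do not affect the others.\<close>

lemma good_local:
  assumes good: "good c"
    and x: "c x = None"
    and same: "\<And>v. \<not> reach (dom c) x v \<Longrightarrow> c' v = c v"
    and dom: "dom c \<subseteq> dom c'" and dang: "dangerous c' \<subseteq> dangerous c"
    and one: "\<And>v. v \<in> dangerous c' \<Longrightarrow> reach (dom c) x v \<Longrightarrow> v = y \<and> card (seen c' v) \<le> 1"
  shows "good c'"
proof -
  let ?K = "\<lambda>v. reach (dom c) x v"
  have K_free: "v \<notin> dom c" if "?K v" for v using reach_avoids[OF that] x by auto
  \<comment> \<open>An uncoloured vertex outside the component has no neighbour in it, so moves
    inside leave its seen colours and potential unchanged.\<close>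
  have nbr_out: "\<not> ?K b" if "E a b" "a \<notin> dom c" "\<not> ?K a" for a b
    using reach_trans[of "dom c" x b a] reach_edge[of b a "dom c"] K_free[of b] sym that by blast
  have eq: "seen c' v = seen c v" "free_nbrs c' v = free_nbrs c v" "potential c' v = potential c v"
    if "v \<notin> dom c" "\<not> ?K v" for v
  proof -
    have "c' u = c u" if "E u v" for u using nbr_out[of v u] same sym \<open>v \<notin> dom c\<close> \<open>\<not> ?K v\<close> that by blast
    then show 1: "seen c' v = seen c v" and 2: "free_nbrs c' v = free_nbrs c v"
      by (auto simp: seen_def free_nbrs_def)
    show "potential c' v = potential c v" by (simp add: potential_def 1 2)
  qed
  have free: "v \<notin> dom c" if "v \<in> dangerous c'" for v
    using that dang by (auto simp: dangerous_def)
  have "card (seen c' v) \<le> 1" if v: "v \<in> dangerous c'" for v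
    using one[OF v] eq[of v] free[OF v] good_seen[OF good, of v] v dang by (cases "?K v") auto
  moreover have "good_pair c' u v"
    if uv: "u \<in> dangerous c'" "v \<in> dangerous c'" "u \<noteq> v" "reach (dom c') u v" for u v
  proof -
    have r: "reach (dom c) a b" if "reach (dom c') a b" for a b using that dom reach_mono by blast
    \<comment> \<open>Components only shrink from \<open>c\<close> to \<open>c'\<close>; were
      \<open>u\<close> in the component of \<open>x\<close>, so would be \<open>v\<close>, and both
      would equal \<open>y\<close>.\<close>
    have out: "\<not> ?K u"
    proof
      assume "?K u"
      then have "?K v" using r uv(4) reach_trans by blast
      then show False using one uv \<open>?K u\<close> by metis
    qed
    have outr: "\<not> ?K a" "a \<notin> dom c" if "reach (dom c) u a" for a
      using out that reach_trans reach_sym apply blast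
      using that free[OF uv(1)] reach_avoids by blast
    have gp: "good_pair c u v" using good_good_pair[OF good] uv dang r by blast
    have "b \<in> dom c" if "reach (dom c) u a" "E a b" "b \<in> dom c'" for a b
      using nbr_out[of a b] outr[of a] that same[of b] by (auto simp: dom_def)
    moreover have "potential c' u = potential c u" "potential c' v = potential c v"
      using eq outr[of u] outr[of v] r uv by auto
    ultimately show ?thesis using gp dang r unfolding good_pair_def
      by (smt (verit, best) subsetD)
  qed
  ultimately show ?thesis unfolding good_def by blast
qed

section \<open>Alice's moves that keep the invariant\<close>

lemma seen_nonempty: "seen c v \<noteq> {} \<Longrightarrow> \<exists>b\<in>dom c. E v b"
  unfolding seen_def using sym by blast

text \<open>Otherwise two vertices of the component would have coloured neighbours.\<close>

lemma good_pair_seen_empty: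
  assumes "good_pair c u v" "reach (dom c) u v" "u \<noteq> v"
  shows "seen c u = {} \<or> seen c v = {}"
proof (rule ccontr)
  assume "\<not> ?thesis"
  then obtain b b' where "b \<in> dom c" "E u b" "b' \<in> dom c" "E v b'" using seen_nonempty by metis
  then show False using assms reach_refl[of "dom c" u] unfolding good_pair_def by blast
qed

text \<open>Serves the positions in which Bob's move has left nothing to repair.\<close>

lemma free_move:
  assumes good: "good c" and nc: "\<not> all_colored V c"
  shows "\<exists>v k. legal_move 3 V E c v k \<and> good (c(v := Some k))"
proof -
  have s2: "card (seen c v) \<le> 2" if "v \<in> V" "c v = None" for v
    using seen_le_2 good_seen[OF good] that by fastforce
  \<comment> \<open>Colouring \<open>u\<close> is safe if its component has at most one other
    dangerous vertex and that one sees nothing: afterwards it sees at most the new colour.\<close>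
  have key: "\<exists>v k. legal_move 3 V E c v k \<and> good (c(v := Some k))"
    if u: "u \<in> V" "c u = None"
      and one: "\<And>v. v \<in> dangerous c \<Longrightarrow> v \<noteq> u \<Longrightarrow> reach (dom c) u v \<Longrightarrow> v = y \<and> seen c v = {}" for u y
  proof -
    obtain k where k: "legal_move 3 V E c u k" using exists_legal[OF u s2[OF u]] by blast
    have "good (c(u := Some k))"
    proof (rule good_local[OF good, where x = u and y = y])
      show "c u = None" by fact
      show "(c(u := Some k)) v = c v" if "\<not> reach (dom c) u v" for v using that by auto
      show "dom c \<subseteq> dom (c(u := Some k))" by auto
      show "dangerous (c(u := Some k)) \<subseteq> dangerous c" using dangerous_upd[of c u k] u by blast
      fix v assume v: "v \<in> dangerous (c(u := Some k))" "reach (dom c) u v"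
      then have "v \<in> dangerous c" "v \<noteq> u" using dangerous_upd[of c u k] u by auto
      with one v have "v = y" "seen c v = {}" by blast+
      then show "v = y \<and> card (seen (c(u := Some k)) v) \<le> 1"
        using card_seen_upd[of c u k v] u by simp
    qed
    with k show ?thesis by blast
  qed
  show ?thesis
  proof (cases "\<exists>u v. u \<in> dangerous c \<and> v \<in> dangerous c \<and> u \<noteq> v \<and> reach (dom c) u v")
    case True
    \<comment> \<open>The pair is ordered so that \<open>v\<close>, the vertex left uncoloured, sees
      no colour.\<close>
    then obtain u v where uv: "u \<in> dangerous c" "v \<in> dangerous c" "u \<noteq> v" "reach (dom c) u v"
      "seen c v = {}"
      using good_pair_seen_empty good_good_pair[OF good] reach_sym by metis
    have "good_pair c u v" using good_good_pair good uv by blast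
    then have "z = v \<and> seen c z = {}" if "z \<in> dangerous c" "z \<noteq> u" "reach (dom c) u z" for z
      using that uv(5) unfolding good_pair_def by blast
    moreover have "u \<in> V" "c u = None" using uv(1) by (auto simp: dangerous_def)
    ultimately show ?thesis using key by blast
  next
    case pairless: False
    show ?thesis
    proof (cases "dangerous c = {}")
      case True
      moreover obtain u where "u \<in> V" "c u = None" using nc by (auto simp: all_colored_def)
      ultimately show ?thesis using key[of u] by blast
    next
      case False
      then obtain u where "u \<in> dangerous c" by blast
      moreover from this have "u \<in> V" "c u = None" by (auto simp: dangerous_def)
      ultimately show ?thesis using key[of u] pairless by blast
    qed
  qed
qed

text \<open>When Bob plays \<open>w\<close> in the component of a pair \<open>u\<close>, \<open>v\<close>, colouring one of them suffices,
unless they are adjacent and see the same single colour. In that case, as one of them has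
potential at most \<open>3\<close>, its last other free neighbour is given that colour.\<close>

lemma reply:
  assumes good: "good c" and bob: "legal_move 3 V E c w k"
    and nc: "\<not> all_colored V (c(w := Some k))"
  shows "\<exists>v j. legal_move 3 V E (c(w := Some k)) v j \<and> good (c(w := Some k, v := Some j))"
proof -
  let ?c = "c(w := Some k)"
  let ?D = "dangerous ?c \<inter> {v. reach (dom c) w v}"
  have w: "w \<in> V" "c w = None" "k < 3" "k \<notin> seen c w" using bob by (auto simp: legal_move_iff)
  have dang: "dangerous ?c \<subseteq> dangerous c - {w}" using dangerous_upd w by blast
  have s2: "card (seen ?c v) \<le> 2" if "v \<in> dangerous ?c" for v
  proof -
    have "card (seen c v) \<le> 1" using good_seen[OF good] that dang by blast
    then show ?thesis using card_seen_upd[of c w k v] w by simp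
  qed
  \<comment> \<open>A reply in the component of \<open>w\<close> restores the invariant if at most
    one dangerous vertex survives there, seeing at most one colour; the fixed \<open>y\<close>
    expresses uniqueness.\<close>
  have key: ?thesis
    if v: "legal_move 3 V E ?c v j" "reach (dom c) w v"
      and one: "\<And>z. z \<in> ?D \<Longrightarrow> z \<noteq> v \<Longrightarrow> z \<in> dangerous (?c(v := Some j)) \<Longrightarrow>
        z = y \<and> card (seen (?c(v := Some j)) z) \<le> 1"
    for v j y
  proof -
    let ?c' = "?c(v := Some j)"
    have v': "?c v = None" using v by (auto simp: legal_move_def)
    have dang': "dangerous ?c' \<subseteq> dangerous ?c - {v}" using dangerous_upd[of ?c v j] v' by blast
    have "good ?c'"
    proof (rule good_local[OF good, where x = w and y = y])
      show "c w = None" by fact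
      show "?c' z = c z" if "\<not> reach (dom c) w z" for z using that v by auto
      show "dom c \<subseteq> dom ?c'" by auto
      show "dangerous ?c' \<subseteq> dangerous c" using dang' dang by blast
      show "z = y \<and> card (seen ?c' z) \<le> 1" if "z \<in> dangerous ?c'" "reach (dom c) w z" for z
        using one[of z] that dang' by blast
    qed
    with v show ?thesis by blast
  qed
  have color_one: ?thesis
    if D: "?D \<subseteq> {u, v}" "u \<in> ?D" and j: "j < 3" "j \<notin> seen ?c u"
      and s: "v \<in> ?D \<Longrightarrow> card (seen (?c(u := Some j)) v) \<le> 1" for u v j
  proof (rule key[of u j v])
    show "legal_move 3 V E ?c u j" using D(2) j by (auto simp: legal_move_iff dangerous_def)
    show "reach (dom c) w u" using D by blast
    show "z = v \<and> card (seen (?c(u := Some j)) z) \<le> 1" if "z \<in> ?D" "z \<noteq> u" for z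
      using that D s by blast
  qed
  have avail: "\<exists>j<3. j \<notin> seen ?c u" if "u \<in> ?D" for u
    using exists_legal[of u ?c] that s2 by (auto simp: legal_move_iff dangerous_def)
  have D_free: "?c u = None" if "u \<in> ?D" for u using that by (auto simp: dangerous_def)
  show ?thesis
  proof (cases "\<exists>u v. u \<in> ?D \<and> v \<in> ?D \<and> u \<noteq> v")
    case False
    show ?thesis
    proof (cases "\<exists>u\<in>?D. card (seen ?c u) = 2")
      case True
      then obtain u where u: "u \<in> ?D" by blast
      then obtain j where "j < 3" "j \<notin> seen ?c u" using avail by blast
      \<comment> \<open>\<open>w\<close> is a dummy for the second vertex: it is coloured, hence not
        in \<open>?D\<close>.\<close>
      then show ?thesis using color_one[of u w j] u False dang by blast
    next
      case small: False
      have "good ?c"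
      \<comment> \<open>\<open>?D\<close> has at most one element, which the choice picks; if
        \<open>?D\<close> is empty, any value will do.\<close>
      proof (rule good_local[OF good, where x = w and y = "SOME u. u \<in> ?D"])
        fix v assume v: "v \<in> dangerous ?c" "reach (dom c) w v"
        then have "?D = {v}" using False by blast
        moreover have "card (seen ?c v) \<noteq> 2" using small v by blast
        then have "card (seen ?c v) \<le> 1" using s2[OF v(1)] by linarith
        ultimately show "v = (SOME u. u \<in> ?D) \<and> card (seen ?c v) \<le> 1" by simp
      qed (use w dang in auto)
      then show ?thesis using free_move nc by blast
    qed
  next
    case True
    have pairs: "?D \<subseteq> {u, v} \<and> good_pair c u v \<and> reach (dom c) u v \<and> (seen c u = {} \<or> seen c v = {})"
      if "u \<in> ?D" "v \<in> ?D" "u \<noteq> v" for u v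
    proof -
      have r: "reach (dom c) u v" using that reach_sym reach_trans by blast
      have gp: "good_pair c u v" using good_good_pair[OF good] that dang r by blast
      have "z = u \<or> z = v" if "z \<in> ?D" for z
      proof -
        have "reach (dom c) u z" using that \<open>u \<in> ?D\<close> reach_sym reach_trans by blast
        then show ?thesis using gp that dang unfolding good_pair_def by blast
      qed
      then show ?thesis using gp r good_pair_seen_empty[OF gp r] that by blast
    qed
    show ?thesis
    \<comment> \<open>In the easy case \<open>u\<close> can take any available colour:
      \<open>v\<close> is either not adjacent to it or sees nothing yet.\<close>
    proof (cases "\<exists>u v. u \<in> ?D \<and> v \<in> ?D \<and> u \<noteq> v \<and> (\<not> E u v \<and> card (seen ?c v) \<le> 1 \<or> seen ?c v = {})")
      case True
      then obtain u v where uv: "u \<in> ?D" "v \<in> ?D" "u \<noteq> v"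
        "\<not> E u v \<and> card (seen ?c v) \<le> 1 \<or> seen ?c v = {}" by blast
      obtain j where "j < 3" "j \<notin> seen ?c u" using avail uv by blast
      moreover have "?c u = None" using D_free uv by blast
      ultimately show ?thesis
        using color_one[of u v j] pairs[of u v] uv seen_upd[of ?c u j v]
        by (auto simp del: fun_upd_apply split: if_splits)
    next
      case hard: False
      \<comment> \<open>As \<open>v\<close> saw nothing before but now sees a colour, Bob has played
        next to \<open>v\<close>; since \<open>u\<close> and \<open>v\<close> are adjacent,
        \<open>w\<close> is not adjacent to \<open>u\<close>.\<close>
      obtain u v where uv: "u \<in> ?D" "v \<in> ?D" "u \<noteq> v" and sv: "seen c v = {}"
        using True pairs by metis
      have "card (seen ?c v) \<le> 1" using card_seen_upd[of c w k v] w sv by simp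
      then have Euv: "E u v" using hard uv by blast
      have ne: "seen ?c u \<noteq> {}" "seen ?c v \<noteq> {}" using hard uv by blast+
      have Ewv: "E w v" "seen ?c v = {k}" using ne sv seen_upd[of c w k v] w
        by (auto split: if_splits)
      have "\<not> E w u" using no_triangle[of w u v] Euv Ewv by blast
      then have su: "seen ?c u = seen c u" using seen_upd w by auto
      obtain a where a: "seen ?c u = {a}"
        using good_seen[OF good, of u] uv dang ne(1) su
        by (metis DiffD1 IntD1 card_1_singletonE card_0_eq finite_seen le_SucE le_zero_eq One_nat_def subsetD)
      show ?thesis
      proof (cases "a = k")
        case False
        \<comment> \<open>Bob's colour is already seen by \<open>v\<close>, so giving it to
          \<open>u\<close> adds nothing there.\<close>
        then have "a \<notin> seen ?c v" "k \<notin> seen ?c u" using Ewv a by auto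
        moreover have "seen (?c(u := Some k)) v = {k}"
          using seen_upd[of ?c u k v] Ewv D_free uv by auto
        ultimately show ?thesis using color_one[of u v k] pairs[of u v] uv w by force
      next
        case True
        obtain b where b: "b \<in> dom c" "E u b" using ne(1) su seen_nonempty by metis
        have gp: "good_pair c u v" "?D \<subseteq> {u, v}" using pairs uv by blast+
        \<comment> \<open>Both see exactly \<open>k\<close>, so colouring either would show the
          other a second colour. With potential \<open>3\<close>, \<open>q\<close> has besides
          \<open>p\<close> exactly one free neighbour \<open>y\<close>; giving \<open>y\<close> the
          colour \<open>k\<close> drops the potential of \<open>q\<close> to
          \<open>2\<close>.\<close>
        have finish: ?thesis
          if pq: "p \<in> ?D" "q \<in> ?D" "p \<noteq> q" "E p q" "{p, q} = {u, v}" "potential c q \<le> 3" for p q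
        proof -
          have sq: "seen ?c p = {k}" "seen ?c q = {k}"
            using pq(5) a True Ewv by (auto simp: doubleton_eq_iff)
          have "potential ?c q \<le> 3" using potential_upd[of c w k q] w pq(6) by simp
          moreover have "3 \<le> potential ?c q" using pq(2) by (auto simp: dangerous_def)
          ultimately have "card (free_nbrs ?c q) = 2" using sq by (simp add: potential_def)
          moreover have "p \<in> free_nbrs ?c q" using pq D_free[of p] by (simp add: free_nbrs_def)
          ultimately obtain y where y: "free_nbrs ?c q = {p, y}" "y \<noteq> p"
            by (auto simp: card_2_iff doubleton_eq_iff)
          then have y': "E y q" "?c y = None" by (auto simp: free_nbrs_def)
          have "y \<noteq> q" using y' irrefl by blast
          have ry: "reach (dom c) w y"
          proof -
            have "reach (dom c) w q" using pq by blast
            moreover have "reach (dom c) q y"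
              using y' D_free[OF pq(2)] sym by (intro reach_edge) (auto split: if_splits)
            ultimately show ?thesis by (rule reach_trans)
          qed
          \<comment> \<open>Such an edge would give the triangle \<open>w\<close>, \<open>y\<close>,
            \<open>v\<close> if \<open>q = v\<close>, and the square \<open>w\<close>,
            \<open>v\<close>, \<open>u\<close>, \<open>y\<close> if \<open>q = u\<close>.\<close>
          have "\<not> E w y"
          proof
            assume "E w y"
            show False
            proof (cases "q = v")
              case True
              then show False using no_triangle[of w y q] y' \<open>E w y\<close> Ewv by blast
            next
              case False
              then have "p = v" "q = u" using pq(3,5) by auto
              then show False using no_square[of w v u y] Ewv Euv y' \<open>E w y\<close> sym y(2) uv dang
                by blast
            qed
          qed
          \<comment> \<open>\<open>u\<close> had a coloured neighbour before Bob's move, so by the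
            last clause of \<open>good_pair\<close> no other vertex of the component had
            one.\<close>
          moreover have "seen c y = {}"
          proof (rule ccontr)
            assume "seen c y \<noteq> {}"
            then obtain b' where "b' \<in> dom c" "E y b'" using seen_nonempty by blast
            moreover have "reach (dom c) u y" using ry uv reach_sym reach_trans by blast
            ultimately have "y = u" using gp(1) b reach_refl[of "dom c" u] unfolding good_pair_def by blast
            then show False using y(2) \<open>y \<noteq> q\<close> pq(5) by blast
          qed
          ultimately have "seen ?c y = {}" using seen_upd[of c w k y] w by auto
          then have legal: "legal_move 3 V E ?c y k"
            using w y' in_V by (auto simp: legal_move_iff)
          let ?c' = "?c(y := Some k)"
          have "\<not> E y p" using no_triangle[of y q p] y' pq(4) sym by blast
          then have "seen ?c' p = {k}" using seen_upd[of ?c y k p] y' sq by auto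
          moreover have "q \<notin> dangerous ?c'"
          proof -
            have "free_nbrs ?c' q = {p}" using y by (auto simp: free_nbrs_def split: if_splits)
            moreover have "seen ?c' q = {k}" using seen_upd[of ?c y k q] y' sq by auto
            ultimately show ?thesis by (simp add: dangerous_def potential_def)
          qed
          ultimately have "z = p \<and> card (seen ?c' z) \<le> 1"
            if "z \<in> ?D" "z \<in> dangerous ?c'" for z
            using that gp(2) pq(5) by (metis One_nat_def card_1_singleton_iff empty_iff insert_iff le_refl subset_iff)
          then show ?thesis using key[OF legal ry] by blast
        qed
        from gp(1) have "potential c u \<le> 3 \<or> potential c v \<le> 3" unfolding good_pair_def by blast
        then show ?thesis
          using finish[of u v] finish[of v u] uv Euv sym by blast
      qed
    qed
  qed
qed

section \<open>Winning from the invariant, and the first move\<close>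

lemma good_alice_wins: "good c \<Longrightarrow> alice_wins_B 3 V E c"
proof (induction "card (V - dom c)" arbitrary: c rule: less_induct)
  case less
  have ns: "\<not> stuck 3 V E c"
    using not_stuck[of c] good_seen[OF less.prems] by fastforce
  show ?case
  proof (cases "all_colored V c")
    case True
    with ns show ?thesis by (rule B_done)
  next
    case False
    with ns show ?thesis
    proof (rule B_move)
      fix w k assume w: "legal_move 3 V E c w k"
      let ?c = "c(w := Some k)"
      have w': "w \<in> V" "c w = None" using w by (auto simp: legal_move_def)
      \<comment> \<open>Bob's move raises the bound on colours seen by dangerous vertices from
        \<open>1\<close> to \<open>2\<close>, so a third one is still available.\<close>
      have "card (seen ?c v) \<le> 2" if "v \<in> dangerous ?c" for v
      proof -
        have "v \<in> dangerous c" using that dangerous_upd[of c w k] w' by blast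
        then show ?thesis using good_seen[OF less.prems, of v] card_seen_upd[of c w k v] w' by simp
      qed
      then have ns': "\<not> stuck 3 V E ?c"
        using not_stuck[of ?c] by blast
      show "alice_wins_A 3 V E ?c"
      proof (cases "all_colored V ?c")
        case True
        with ns' show ?thesis by (rule A_done)
      next
        case False
        then obtain v j where v: "legal_move 3 V E ?c v j" "good (?c(v := Some j))"
          using reply[OF less.prems w] by blast
        have "V - dom (?c(v := Some j)) \<subset> V - dom c" using w' by auto
        then have "card (V - dom (?c(v := Some j))) < card (V - dom c)"
          using finite_V by (simp add: psubset_card_mono)
        then have "alice_wins_B 3 V E (?c(v := Some j))" using less.hyps v by blast
        with ns' v(1) show ?thesis by (rule A_move)
      qed
    qed
  qed
qed

lemma good_first_move:
  assumes x: "x \<in> V" and light: "\<And>u. u \<in> V - {x} \<Longrightarrow> weight {v. reach {x} u v} < 6"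
  shows "good ((\<lambda>_. None)(x := Some 0))"
proof -
  let ?e = "\<lambda>_. None"
  let ?c = "?e(x := Some 0)"
  have dom: "dom ?c = {x}" by auto
  \<comment> \<open>In the empty colouring the potential is the degree.\<close>
  have pot: "potential ?c v \<le> card (nbrs v)" for v
    using potential_upd[of ?e x 0 v]
    by (simp add: potential_def[of ?e] seen_def free_nbrs_def nbrs_def)
  have seen: "card (seen ?c v) \<le> 1" for v
    using card_seen_upd[of ?e x 0 v] by (simp add: seen_def[of ?e])
  have D: "v \<in> V - {x} \<and> 3 \<le> card (nbrs v)" if "v \<in> dangerous ?c" for v
    using that pot[of v] by (auto simp: dangerous_def split: if_splits)
  have "good_pair ?c u v"
    if uv: "u \<in> dangerous ?c" "v \<in> dangerous ?c" "u \<noteq> v" "reach {x} u v" for u v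
  proof -
    let ?K = "{v. reach {x} u v}"
    have KV: "?K \<subseteq> V" using reach_in_V D uv by blast
    have weight_sub: "weight A < 6" if "A \<subseteq> ?K" for A
      using weight_mono[OF that KV] light[of u] D[OF uv(1)] by simp
    have "card (nbrs u) \<le> 3 \<or> card (nbrs v) \<le> 3"
      using weight_sub[of "{u, v}"] uv by (auto simp: weight_def)
    then have "potential ?c u \<le> 3 \<or> potential ?c v \<le> 3"
      using pot[of u] pot[of v] by linarith
    moreover have "z = u \<or> z = v" if "z \<in> dangerous ?c" "reach {x} u z" for z
    proof (rule ccontr)
      assume "\<not> ?thesis"
      then show False
        using weight_sub[of "{u, v, z}"] uv that D[of u] D[of v] D[of z] by (auto simp: weight_def)
    qed
    \<comment> \<open>Each component left by deleting \<open>x\<close> contains at most one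
      neighbour of \<open>x\<close>, the only coloured vertex.\<close>
    moreover have "a = a'" if "reach {x} u a" "reach {x} u a'" "E a x" "E a' x" for a a'
      using neighbours_separated[of x a a' "{x}"] that reach_sym reach_trans sym by blast
    ultimately show ?thesis unfolding good_pair_def dom by blast
  qed
  then show ?thesis unfolding good_def dom using seen by blast
qed

lemma alice_wins_game_3:
  assumes "card V \<le> 13"
  shows "alice_wins_game 3 V E"
proof -
  let ?e = "\<lambda>_. None"
  have ns: "\<not> stuck 3 V E ?e" by (auto simp: stuck_def intro!: exI[of _ 0])
  show ?thesis unfolding alice_wins_game_def
  proof (cases "V = {}")
    case True
    then show "alice_wins_A 3 V E ?e" using A_done[OF ns] by (simp add: all_colored_def)
  next
    case False
    \<comment> \<open>The weight is at most \<open>13 - 2 = 11\<close>, which allows the threshold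
      \<open>6\<close> for the centroid.\<close>
    have "weight V < 2 * 6" using weight_V assms by simp
    then obtain x where x: "x \<in> V" "\<forall>u\<in>V - {x}. weight {v. reach {x} u v} < 6"
      using exists_centroid False by blast
    then have "alice_wins_B 3 V E (?e(x := Some 0))"
      using good_first_move good_alice_wins by blast
    moreover have "legal_move 3 V E ?e x 0" using x by (simp add: legal_move_def)
    ultimately show "alice_wins_A 3 V E ?e" using A_move[OF ns] by blast
  qed
qed

end

theorem theorem5p5:
  fixes V :: "'a set" and E :: "'a \<Rightarrow> 'a \<Rightarrow> bool"
  assumes "forest V E" and "card V \<le> 13"
  shows "game_chromatic_number V E \<le> 3"
proof -
  interpret forest_graph V E by (rule forest_graph.intro) (rule assms)
  show ?thesis unfolding game_chromatic_number_def
    by (rule Least_le) (rule alice_wins_game_3[OF assms(2)])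
qed

end
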